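(* Let $Q,R\subseteq\mathbb{F}_2^n$ and define $Q\bullet R\subseteq\mathbb{F}_2^{n+2}$ by \[Q\bullet R:=\{\mathbf{v}00\mid \mathbf{v}\in Q\cap R\}\cup\{\mathbf{v}01\mid \mathbf{v}\in Q\setminus R\}\cup\{\mathbf{v}10\mid \mathbf{v}\in R\setminus Q\}\cup\{\mathbf{v}11\mid \mathbf{v}\in\mathbb{F}_2^n\setminus(Q\cup R)\},\] where $\mathbf{v}ab$ denotes $\mathbf{v}$ with the bits $a,b$ appended. Then $Q\bullet R$ is a powerful set if and only if $Q$, $R$ and $Q\cap R$ are all powerful sets.
   Context: A set $S\subseteq\mathbb{F}_2^n$ (positions indexed by $[n]$) is a powerful set if for every $X\subseteq[n]$ the number of vectors in $S$ that are zero in all positions of $X$ is a power of $2$. *)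

theory Defs
  imports Main "HOL-Library.Z2"
begin

text \<open>
  The type \<^typ>\<open>bit\<close> is the field with two elements. Vectors of length \<open>n\<close> over it are lists,
  and positions are counted from \<open>0\<close>, so that the position set is \<open>{..<n}\<close>.
\<close>

definition F2_space :: "nat \<Rightarrow> bit list set" where
  "F2_space n = {v. length v = n}"

definition powerful_set :: "nat \<Rightarrow> bit list set \<Rightarrow> bool" where
  "powerful_set n S \<longleftrightarrow>
     S \<subseteq> F2_space n \<and>
     (\<forall>X \<subseteq> {..<n}. \<exists>k. card {v \<in> S. \<forall>i\<in>X. v ! i = 0} = 2 ^ k)"

definition bullet :: "nat \<Rightarrow> bit list set \<Rightarrow> bit list set \<Rightarrow> bit list set" where
  "bullet n Q R =
     {v @ [0, 0] | v. v \<in> Q \<inter> R} \<union>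
     {v @ [0, 1] | v. v \<in> Q - R} \<union>
     {v @ [1, 0] | v. v \<in> R - Q} \<union>
     {v @ [1, 1] | v. v \<in> F2_space n - (Q \<union> R)}"

end

theory Submission
  imports Defs
begin

text \<open>
  The two appended bits record non-membership in \<open>Q\<close> and in \<open>R\<close>, so the bullet set is a copy of
  the whole space. Forcing neither, the first, the second, or both of these bits to vanish counts the
  zero-restricted vectors of the whole space, \<open>Q\<close>, \<open>R\<close> or \<open>Q \<inter> R\<close> respectively, and the
  first of these counts is always a power of two.
\<close>

text \<open>Splitting off the head identifies these lists with pairs of an element of
  \<open>A 0\<close> and a tail constrained by the shifted family
  \<open>\<lambda>i. A (Suc i)\<close>; the induction must therefore generalize over
  \<open>A\<close>.\<close>

lemma card_lists_nth_in:
  "card {v. length v = n \<and> (\<forall>i<n. v ! i \<in> A i)} = (\<Prod>i<n. card (A i))"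
proof (induction n arbitrary: A)
  case (Suc n)
  let ?S = "{v. length v = n \<and> (\<forall>i<n. v ! i \<in> A (Suc i))}"
  have "{v. length v = Suc n \<and> (\<forall>i<Suc n. v ! i \<in> A i)} = (\<lambda>(x, v). x # v) ` (A 0 \<times> ?S)"
    by (force simp: All_less_Suc2 length_Suc_conv)
  moreover have "inj_on (\<lambda>(x, v). x # v) (A 0 \<times> ?S)"
    by (auto simp: inj_on_def)
  ultimately show ?case
    by (simp add: card_image card_cartesian_product Suc.IH prod.lessThan_Suc_shift
        del: prod.lessThan_Suc)
qed simp

lemma powerful_F2_space: "powerful_set n (F2_space n)"
  unfolding powerful_set_def
proof (intro conjI allI impI)
  fix X :: "nat set"
  assume X: "X \<subseteq> {..<n}"
  \<comment> \<open>Forcing zeros on \<open>X\<close> becomes a box constraint with one choice at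
    each position of \<open>X\<close> and two elsewhere. The exponent obtained below is thus the
    number of free positions.\<close>
  define A :: "nat \<Rightarrow> bit set" where "A i = (if i \<in> X then {0} else UNIV)" for i
  have "{v \<in> F2_space n. \<forall>i\<in>X. v ! i = 0} = {v. length v = n \<and> (\<forall>i<n. v ! i \<in> A i)}"
    using X by (auto simp: F2_space_def A_def)
  moreover have "(UNIV :: bit set) = {0, 1}"
    by auto
  then have "card (UNIV :: bit set) = card {0, 1 :: bit}"
    by (rule arg_cong)
  then have "card (A i) = 2 ^ (if i \<in> X then 0 else 1)" for i
    by (simp add: A_def)
  ultimately have "card {v \<in> F2_space n. \<forall>i\<in>X. v ! i = 0} = 2 ^ (\<Sum>i<n. if i \<in> X then 0 else 1)"
    by (simp only: card_lists_nth_in power_sum)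
  then show "\<exists>k. card {v \<in> F2_space n. \<forall>i\<in>X. v ! i = 0} = 2 ^ k" ..
qed simp

text \<open>The four pieces split the space by membership in \<open>Q\<close> and \<open>R\<close>,
  and on each piece the conditional bits are the constants appended there.\<close>

lemma bullet_eq_image:
  assumes "Q \<subseteq> F2_space n" and "R \<subseteq> F2_space n"
  shows "bullet n Q R =
           (\<lambda>v. v @ [if v \<in> Q then 0 else 1, if v \<in> R then 0 else 1]) ` F2_space n"
    (is "_ = ?f ` _")
proof -
  have "{v @ [0, 0] | v. v \<in> Q \<inter> R} = ?f ` (Q \<inter> R)"
    "{v @ [0, 1] | v. v \<in> Q - R} = ?f ` (Q - R)"
    "{v @ [1, 0] | v. v \<in> R - Q} = ?f ` (R - Q)"
    "{v @ [1, 1] | v. v \<in> F2_space n - (Q \<union> R)} = ?f ` (F2_space n - (Q \<union> R))"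
    by (auto simp: image_def)
  then have "bullet n Q R = ?f ` ((Q \<inter> R) \<union> (Q - R) \<union> (R - Q) \<union> (F2_space n - (Q \<union> R)))"
    by (simp only: bullet_def image_Un)
  also have "(Q \<inter> R) \<union> (Q - R) \<union> (R - Q) \<union> (F2_space n - (Q \<union> R)) = F2_space n"
    using assms by blast
  finally show ?thesis .
qed

text \<open>The bit at position \<open>n\<close> vanishes exactly on \<open>Q\<close> and the one at
  \<open>Suc n\<close> exactly on \<open>R\<close>, and deleting both bits is injective on the
  bullet set. Taking \<open>UNIV\<close> for an unconstrained bit treats all four cases at
  once.\<close>

lemma card_bullet_zeros:
  assumes Q: "Q \<subseteq> F2_space n" and R: "R \<subseteq> F2_space n" and Y: "Y \<subseteq> {..<n + 2}"
  shows "card {w \<in> bullet n Q R. \<forall>i\<in>Y. w ! i = 0} =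
         card {v \<in> F2_space n \<inter> (if n \<in> Y then Q else UNIV) \<inter> (if Suc n \<in> Y then R else UNIV).
                 \<forall>i\<in>Y \<inter> {..<n}. v ! i = 0}"
    (is "card ?L = card ?V")
proof -
  define f :: "bit list \<Rightarrow> bit list"
    where "f = (\<lambda>v. v @ [if v \<in> Q then 0 else 1, if v \<in> R then 0 else 1])"
  \<comment> \<open>The bound on \<open>Y\<close> leaves only \<open>n\<close> and
    \<open>Suc n\<close> as positions outside the original vector.\<close>
  have Y_cases: "(\<forall>i\<in>Y. P i) \<longleftrightarrow>
      (\<forall>i\<in>Y \<inter> {..<n}. P i) \<and> (n \<in> Y \<longrightarrow> P n) \<and> (Suc n \<in> Y \<longrightarrow> P (Suc n))" for P
    using Y by (auto simp: subset_iff less_Suc_eq numeral_2_eq_2)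
  have mem_if: "v \<in> (if b then S else UNIV) \<longleftrightarrow> (b \<longrightarrow> v \<in> S)" for v b and S :: "bit list set"
    by simp
  have f_zeros: "(\<forall>i\<in>Y. f v ! i = 0) \<longleftrightarrow>
      (\<forall>i\<in>Y \<inter> {..<n}. v ! i = 0) \<and> (n \<in> Y \<longrightarrow> v \<in> Q) \<and> (Suc n \<in> Y \<longrightarrow> v \<in> R)"
    if "v \<in> F2_space n" for v
    using that unfolding Y_cases by (auto simp: f_def F2_space_def nth_append)
  have "{v \<in> F2_space n. \<forall>i\<in>Y. f v ! i = 0} = ?V"
    using f_zeros unfolding Int_iff mem_if by blast
  moreover have "?L = f ` {v \<in> F2_space n. \<forall>i\<in>Y. f v ! i = 0}"
    unfolding bullet_eq_image[OF Q R] f_def[symmetric] by blast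
  moreover have "inj_on f ?V"
    by (auto simp: inj_on_def f_def)
  ultimately show ?thesis
    by (simp add: card_image)
qed

theorem theorem11:
  fixes n :: nat and Q R :: "bit list set"
  assumes "Q \<subseteq> F2_space n" and "R \<subseteq> F2_space n"
  shows "powerful_set (n + 2) (bullet n Q R) \<longleftrightarrow>
           powerful_set n Q \<and> powerful_set n R \<and> powerful_set n (Q \<inter> R)"
proof
  assume bullet: "powerful_set (n + 2) (bullet n Q R)"
  \<comment> \<open>\<open>X\<close> and \<open>Z\<close> vary independently: \<open>Z\<close>
    selects the set to be counted, \<open>X\<close> the zeros imposed on it. Their union is the
    position set tested in the bullet set.\<close>
  have pow: "\<exists>k. card {v \<in> F2_space n \<inter> (if n \<in> Z then Q else UNIV) \<inter> (if Suc n \<in> Z then R else UNIV).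
                  \<forall>i\<in>X. v ! i = 0} = 2 ^ k"
    if X: "X \<subseteq> {..<n}" and Z: "Z \<subseteq> {n, Suc n}" for X Z
  proof -
    have Y: "X \<union> Z \<subseteq> {..<n + 2}"
      using X Z by fastforce
    have "(X \<union> Z) \<inter> {..<n} = X" "n \<in> X \<union> Z \<longleftrightarrow> n \<in> Z" "Suc n \<in> X \<union> Z \<longleftrightarrow> Suc n \<in> Z"
      using X Z by auto
    moreover have "\<exists>k. card {w \<in> bullet n Q R. \<forall>i\<in>X \<union> Z. w ! i = 0} = 2 ^ k"
      using bullet Y unfolding powerful_set_def by blast
    ultimately show ?thesis
      by (simp only: card_bullet_zeros[OF assms Y])
  qed
  have "F2_space n \<inter> Q = Q" "F2_space n \<inter> R = R"
    using assms by auto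
  \<comment> \<open>The three choices of \<open>Z\<close> select \<open>Q\<close>, \<open>R\<close>
    and \<open>Q \<inter> R\<close> in turn.\<close>
  then show "powerful_set n Q \<and> powerful_set n R \<and> powerful_set n (Q \<inter> R)"
    using pow[of _ "{n}"] pow[of _ "{Suc n}"] pow[of _ "{n, Suc n}"] assms
    unfolding powerful_set_def by auto
next
  assume "powerful_set n Q \<and> powerful_set n R \<and> powerful_set n (Q \<inter> R)"
  moreover have "F2_space n \<inter> Q = Q" "F2_space n \<inter> R = R"
    using assms by auto
  \<comment> \<open>If \<open>Y\<close> contains neither appended position, the set is the whole
    space; the other three cases are the assumptions.\<close>
  ultimately have "powerful_set n
      (F2_space n \<inter> (if n \<in> Y then Q else UNIV) \<inter> (if Suc n \<in> Y then R else UNIV))" for Y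
    using powerful_F2_space by auto
  then have pow: "X \<subseteq> {..<n} \<Longrightarrow>
      \<exists>k. card {v \<in> F2_space n \<inter> (if n \<in> Y then Q else UNIV) \<inter> (if Suc n \<in> Y then R else UNIV).
            \<forall>i\<in>X. v ! i = 0} = 2 ^ k" for X Y
    by (simp only: powerful_set_def)
  have "bullet n Q R \<subseteq> F2_space (n + 2)"
    unfolding bullet_eq_image[OF assms] by (auto simp: F2_space_def)
  moreover have "\<exists>k. card {w \<in> bullet n Q R. \<forall>i\<in>Y. w ! i = 0} = 2 ^ k"
    if "Y \<subseteq> {..<n + 2}" for Y
    unfolding card_bullet_zeros[OF assms that] by (rule pow) simp
  ultimately show "powerful_set (n + 2) (bullet n Q R)"
    unfolding powerful_set_def by blast
qed

end
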